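(* Let $(P_t)_{t\ge0}$ be the family (indexed by $d\in\mathbb{N}$) of Markov semigroups acting on functions $\boldsymbol{f}:\Omega\to\mathbb{H}_d$ by $(P_t\boldsymbol{f})(z)=\mathbb{E}[\boldsymbol{f}(Z_t)\mid Z_0=z]$, where $(Z_t)_{t\ge0}$ is a time-homogeneous Markov process on a Polish space $\Omega$ with stationary probability measure $\mu$. Let $c>0$. The following statements are equivalent: (1) (Scalar Bakry--\'Emery criterion) $\Gamma(f)\le c\cdot\Gamma_2(f)$ for all suitable $f:\Omega\to\mathbb{R}$. (2) (Matrix Bakry--\'Emery criterion) $\Gamma(\boldsymbol{f})\preccurlyeq c\cdot\Gamma_2(\boldsymbol{f})$ for all suitable $\boldsymbol{f}:\Omega\to\mathbb{H}_d$ and all $d\in\mathbb{N}$. (Both inequalities are understood pointwise $\mu$-almost everywhere.)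
   Context: $\mathbb{M}_d$ is the algebra of $d\times d$ complex matrices, $\mathbb{H}_d$ its real subspace of Hermitian matrices; $\preccurlyeq$ is the positive-semidefinite order. The infinitesimal generator is $\mathcal{L}\boldsymbol{f}=\lim_{t\downarrow0}(P_t\boldsymbol{f}-\boldsymbol{f})/t$ (entrywise, also for $\mathbb{M}_d$-valued functions). The matrix carr\'e du champ and iterated carr\'e du champ operators are $$\Gamma(\boldsymbol{f},\boldsymbol{g})=\tfrac12[\mathcal{L}(\boldsymbol{f}\boldsymbol{g})-\boldsymbol{f}\mathcal{L}(\boldsymbol{g})-\mathcal{L}(\boldsymbol{f})\boldsymbol{g}],\qquad \Gamma_2(\boldsymbol{f},\boldsymbol{g})=\tfrac12[\mathcal{L}\Gamma(\boldsymbol{f},\boldsymbol{g})-\Gamma(\boldsymbol{f},\mathcal{L}(\boldsymbol{g}))-\Gamma(\mathcal{L}(\boldsymbol{f}),\boldsymbol{g})],$$ with $\Gamma(\boldsymbol{f})=\Gamma(\boldsymbol{f},\boldsymbol{f})$ and $\Gamma_2(\boldsymbol{f})=\Gamma_2(\boldsymbol{f},\boldsymbol{f})$; for $d=1$ these are the usual scalar operators. Suitable functions: for each $d$, a fixed class of functions $\Omega\to\mathbb{H}_d$ (an algebra of nice functions, e.g. smooth compactly supported ones in concrete cases) on which $\mathcal{L},\Gamma,\Gamma_2$ are defined, which is compatible with the operations used ($P_t$, $\mathcal{L}$, sums, products, constants; $\boldsymbol{f}$ is suitable iff the real and imaginary parts of its entries are suitable real-valued functions), and on which all limits, time derivatives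 and expectations involved exist and may be interchanged. *)

theory Defs
  imports
    "HOL-Probability.Probability"
    "Jordan_Normal_Form.Schur_Decomposition"
begin

section \<open>Hermitian matrices and the positive-semidefinite order\<close>

definition hermitian_mats :: "nat \<Rightarrow> complex mat set" where
  "hermitian_mats d = {A \<in> carrier_mat d d. mat_adjoint A = A}"

text \<open>The comparison with \<open>0\<close> is in the order on \<open>\<complex>\<close>, where \<open>0 \<le> w\<close> means that
  \<open>w\<close> is real and nonnegative.\<close>

definition psd :: "nat \<Rightarrow> complex mat \<Rightarrow> bool" where
  "psd d A \<longleftrightarrow> A \<in> hermitian_mats d \<and> (\<forall>v \<in> carrier_vec d. 0 \<le> (A *\<^sub>v v) \<bullet>c v)"

definition loewner_le :: "nat \<Rightarrow> complex mat \<Rightarrow> complex mat \<Rightarrow> bool" where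
  "loewner_le d A B \<longleftrightarrow> A \<in> hermitian_mats d \<and> B \<in> hermitian_mats d \<and> psd d (B - A)"


section \<open>Markov processes\<close>

definition past :: "'w measure \<Rightarrow> (real \<Rightarrow> 'w \<Rightarrow> 'a::topological_space) \<Rightarrow> real \<Rightarrow> 'w measure" where
  "past W Z s =
     sigma (space W) {Z u -` B \<inter> space W | u B. 0 \<le> u \<and> u \<le> s \<and> B \<in> sets borel}"

text \<open>The process is given with its family of laws: \<open>Pr z\<close> is the law, on the path space \<open>W\<close>,
  of the process started at \<open>z\<close>, so that expectations under \<open>Pr z\<close> are the conditional
  expectations given \<open>Z\<^sub>0 = z\<close>, defined for every \<open>z\<close>.  Only the values \<open>Z t\<close> for \<open>t \<ge> 0\<close>
  matter.\<close>

locale markov_process =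
  fixes W :: "'w measure"
    and Pr :: "'a::polish_space \<Rightarrow> 'w measure"
    and Z :: "real \<Rightarrow> 'w \<Rightarrow> 'a"
  assumes law_kernel: "Pr \<in> borel \<rightarrow>\<^sub>M prob_algebra W"
    and process_measurable: "\<And>t. 0 \<le> t \<Longrightarrow> Z t \<in> W \<rightarrow>\<^sub>M borel"
    and start: "\<And>z. AE \<omega> in Pr z. Z 0 \<omega> = z"
    and markov_property:
      "\<And>z s t B. \<lbrakk>0 \<le> s; 0 \<le> t; B \<in> sets borel\<rbrakk> \<Longrightarrow>
         AE \<omega> in Pr z.
           real_cond_exp (Pr z) (past W Z s) (indicator (Z (s + t) -` B \<inter> space W)) \<omega>
           = measure (Pr (Z s \<omega>)) (Z t -` B \<inter> space W)"

text \<open>\<open>\<mu> \<bind> Pr\<close> is the law of the process with initial distribution \<open>\<mu>\<close>.\<close>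

locale stationary_markov_process = markov_process W Pr Z
  for W :: "'w measure" and Pr :: "'a::polish_space \<Rightarrow> 'w measure" and Z :: "real \<Rightarrow> 'w \<Rightarrow> 'a" +
  fixes \<mu> :: "'a measure"
  assumes \<mu>_prob: "prob_space \<mu>"
    and \<mu>_sets: "sets \<mu> = sets borel"
    and stationary: "\<And>t. 0 \<le> t \<Longrightarrow> distr (\<mu> \<bind> Pr) borel (Z t) = \<mu>"


section \<open>Semigroup, generator and scalar carr\'e du champ operators\<close>

definition semigroup_op ::
    "('a \<Rightarrow> 'w measure) \<Rightarrow> (real \<Rightarrow> 'w \<Rightarrow> 'a) \<Rightarrow> real
      \<Rightarrow> ('a \<Rightarrow> 'b::{banach, second_countable_topology}) \<Rightarrow> 'a \<Rightarrow> 'b" where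
  "semigroup_op Pr Z t f z = (\<integral>\<omega>. f (Z t \<omega>) \<partial>Pr z)"

definition gen ::
    "('a \<Rightarrow> 'w measure) \<Rightarrow> (real \<Rightarrow> 'w \<Rightarrow> 'a)
      \<Rightarrow> ('a \<Rightarrow> 'b::{banach, second_countable_topology}) \<Rightarrow> 'a \<Rightarrow> 'b" where
  "gen Pr Z f z = Lim (at_right 0) (\<lambda>t. (semigroup_op Pr Z t f z - f z) /\<^sub>R t)"

definition carre_du_champ ::
    "('a \<Rightarrow> 'w measure) \<Rightarrow> (real \<Rightarrow> 'w \<Rightarrow> 'a)
      \<Rightarrow> ('a \<Rightarrow> real) \<Rightarrow> ('a \<Rightarrow> real) \<Rightarrow> 'a \<Rightarrow> real" where
  "carre_du_champ Pr Z f g z =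
     1/2 * (gen Pr Z (\<lambda>x. f x * g x) z - f z * gen Pr Z g z - gen Pr Z f z * g z)"

definition carre_du_champ2 ::
    "('a \<Rightarrow> 'w measure) \<Rightarrow> (real \<Rightarrow> 'w \<Rightarrow> 'a)
      \<Rightarrow> ('a \<Rightarrow> real) \<Rightarrow> ('a \<Rightarrow> real) \<Rightarrow> 'a \<Rightarrow> real" where
  "carre_du_champ2 Pr Z f g z =
     1/2 * (gen Pr Z (carre_du_champ Pr Z f g) z
            - carre_du_champ Pr Z f (gen Pr Z g) z - carre_du_champ Pr Z (gen Pr Z f) g z)"


section \<open>Matrix generator and matrix carr\'e du champ operators\<close>

text \<open>Matrix-valued expectations and limits are entrywise.\<close>

definition semigroup_mat ::
    "('a \<Rightarrow> 'w measure) \<Rightarrow> (real \<Rightarrow> 'w \<Rightarrow> 'a) \<Rightarrow> nat \<Rightarrow> real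
      \<Rightarrow> ('a \<Rightarrow> complex mat) \<Rightarrow> 'a \<Rightarrow> complex mat" where
  "semigroup_mat Pr Z d t f z = mat d d (\<lambda>(i, j). \<integral>\<omega>. f (Z t \<omega>) $$ (i, j) \<partial>Pr z)"

definition gen_mat ::
    "('a \<Rightarrow> 'w measure) \<Rightarrow> (real \<Rightarrow> 'w \<Rightarrow> 'a) \<Rightarrow> nat
      \<Rightarrow> ('a \<Rightarrow> complex mat) \<Rightarrow> 'a \<Rightarrow> complex mat" where
  "gen_mat Pr Z d f z =
     mat d d (\<lambda>(i, j). Lim (at_right 0)
       (\<lambda>t. (semigroup_mat Pr Z d t f z $$ (i, j) - f z $$ (i, j)) /\<^sub>R t))"

definition carre_du_champ_mat ::
    "('a \<Rightarrow> 'w measure) \<Rightarrow> (real \<Rightarrow> 'w \<Rightarrow> 'a) \<Rightarrow> nat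
      \<Rightarrow> ('a \<Rightarrow> complex mat) \<Rightarrow> ('a \<Rightarrow> complex mat) \<Rightarrow> 'a \<Rightarrow> complex mat" where
  "carre_du_champ_mat Pr Z d f g z =
     (1/2) \<cdot>\<^sub>m (gen_mat Pr Z d (\<lambda>x. f x * g x) z
                - f z * gen_mat Pr Z d g z - gen_mat Pr Z d f z * g z)"

definition carre_du_champ2_mat ::
    "('a \<Rightarrow> 'w measure) \<Rightarrow> (real \<Rightarrow> 'w \<Rightarrow> 'a) \<Rightarrow> nat
      \<Rightarrow> ('a \<Rightarrow> complex mat) \<Rightarrow> ('a \<Rightarrow> complex mat) \<Rightarrow> 'a \<Rightarrow> complex mat" where
  "carre_du_champ2_mat Pr Z d f g z =
     (1/2) \<cdot>\<^sub>m (gen_mat Pr Z d (carre_du_champ_mat Pr Z d f g) z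
                - carre_du_champ_mat Pr Z d f (gen_mat Pr Z d g) z
                - carre_du_champ_mat Pr Z d (gen_mat Pr Z d f) g z)"


section \<open>Suitable functions\<close>

text \<open>\<open>S\<close> is the class of suitable real-valued functions.  The last four assumptions say that the
  generator is defined on \<open>S\<close> and that its limit may be interchanged with the expectations under
  \<open>Pr z\<close> and \<open>\<mu>\<close>; the middle two state
  \<open>\<partial>\<^sub>t P\<^sub>t f = P\<^sub>t (L f) = L (P\<^sub>t f)\<close>, with one-sided derivative at \<open>t = 0\<close>.\<close>

locale suitable_class = stationary_markov_process W Pr Z \<mu>
  for W :: "'w measure" and Pr :: "'a::polish_space \<Rightarrow> 'w measure" and Z :: "real \<Rightarrow> 'w \<Rightarrow> 'a"
    and \<mu> :: "'a measure" +
  fixes S :: "('a \<Rightarrow> real) set"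
  assumes suitable_const: "\<And>a. (\<lambda>_. a) \<in> S"
    and suitable_add: "\<And>f g. \<lbrakk>f \<in> S; g \<in> S\<rbrakk> \<Longrightarrow> (\<lambda>z. f z + g z) \<in> S"
    and suitable_mult: "\<And>f g. \<lbrakk>f \<in> S; g \<in> S\<rbrakk> \<Longrightarrow> (\<lambda>z. f z * g z) \<in> S"
    and suitable_semigroup: "\<And>f t. \<lbrakk>f \<in> S; 0 \<le> t\<rbrakk> \<Longrightarrow> semigroup_op Pr Z t f \<in> S"
    and suitable_gen: "\<And>f. f \<in> S \<Longrightarrow> gen Pr Z f \<in> S"
    and suitable_measurable: "\<And>f. f \<in> S \<Longrightarrow> f \<in> borel_measurable borel"
    and suitable_integrable:
      "\<And>f t z. \<lbrakk>f \<in> S; 0 \<le> t\<rbrakk> \<Longrightarrow> integrable (Pr z) (\<lambda>\<omega>. f (Z t \<omega>))"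
    and suitable_integrable_\<mu>: "\<And>f. f \<in> S \<Longrightarrow> integrable \<mu> f"
    and generator_limit:
      "\<And>f z. f \<in> S \<Longrightarrow>
         ((\<lambda>t. (semigroup_op Pr Z t f z - f z) /\<^sub>R t) \<longlongrightarrow> gen Pr Z f z) (at_right 0)"
    and time_derivative:
      "\<And>f t z. \<lbrakk>f \<in> S; 0 \<le> t\<rbrakk> \<Longrightarrow>
         ((\<lambda>s. semigroup_op Pr Z s f z) has_real_derivative semigroup_op Pr Z t (gen Pr Z f) z)
           (at t within {0..})"
    and gen_commute:
      "\<And>f t z. \<lbrakk>f \<in> S; 0 \<le> t\<rbrakk> \<Longrightarrow>
         gen Pr Z (semigroup_op Pr Z t f) z = semigroup_op Pr Z t (gen Pr Z f) z"
    and expectation_limit: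
      "\<And>f. f \<in> S \<Longrightarrow>
         ((\<lambda>t. \<integral>z. (semigroup_op Pr Z t f z - f z) /\<^sub>R t \<partial>\<mu>) \<longlongrightarrow> (\<integral>z. gen Pr Z f z \<partial>\<mu>))
           (at_right 0)"

definition suitable_mat :: "('a \<Rightarrow> real) set \<Rightarrow> nat \<Rightarrow> ('a \<Rightarrow> complex mat) set" where
  "suitable_mat S d =
     {f. (\<forall>z. f z \<in> hermitian_mats d) \<and>
         (\<forall>i<d. \<forall>j<d. (\<lambda>z. Re (f z $$ (i, j))) \<in> S \<and> (\<lambda>z. Im (f z $$ (i, j))) \<in> S)}"

end

theory Submission
  imports Defs
begin

text \<open>
  Extend \<open>L\<close>, \<open>\<Gamma>\<close> and \<open>\<Gamma>\<^sub>2\<close> to complex-valued functions whose real and imaginary parts are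
  suitable.  On these functions \<open>L\<close> is complex linear and commutes with conjugation, so \<open>\<Gamma>\<close> and
  \<open>\<Gamma>\<^sub>2\<close> are, at each point \<open>z\<close>, symmetric complex bilinear forms that commute with conjugation.
  The matrix operators are matrix products with respect to these forms: the \<open>(i, j)\<close> entry of
  \<open>\<Gamma>(f)\<close> is \<open>\<Sum>k. \<Gamma>(f\<^sub>i\<^sub>k, f\<^sub>k\<^sub>j)\<close>, and likewise for \<open>\<Gamma>\<^sub>2\<close>.  Since \<open>f\<^sub>i\<^sub>k\<close> is the conjugate of
  \<open>f\<^sub>k\<^sub>i\<close>, bilinearity collapses the quadratic form of \<open>A = c \<Gamma>\<^sub>2(f) - \<Gamma>(f)\<close> at a vector \<open>v\<close> into
  a sum of scalar defects \<open>Q(h) = c \<Gamma>\<^sub>2(h) - \<Gamma>(h)\<close>: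
  \<open>v\<^sup>* A v = \<Sum>k. Q(Re g\<^sub>k) + Q(Im g\<^sub>k)\<close>, where \<open>g\<^sub>k = \<Sum>j. v\<^sub>j f\<^sub>k\<^sub>j\<close> is the \<open>k\<close>-th entry of \<open>f v\<close>
  (\<open>defect_quadratic_form\<close>).

  For a fixed \<open>v\<close> the scalar criterion therefore gives \<open>v\<^sup>* A v \<ge> 0\<close> outside a null set that
  depends on \<open>v\<close>.  Countably many \<open>v\<close> share one null set, and outside it nonnegativity on a
  countable dense set of vectors extends to all vectors by continuity
  (\<open>quadratic_form_nonneg_dense\<close>).  The converse is the case of \<open>1 \<times> 1\<close> matrices.
\<close>

section \<open>Hermitian matrices and their quadratic forms\<close>

lemma hermitian_mats_iff:
  "A \<in> hermitian_mats d \<longleftrightarrow>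
     A \<in> carrier_mat d d \<and> (\<forall>i<d. \<forall>j<d. A $$ (j, i) = cnj (A $$ (i, j)))"
proof -
  have dims: "mat_adjoint A \<in> carrier_mat d d" if "A \<in> carrier_mat d d"
    using that by (auto simp: mat_adjoint_def)
  have entry: "mat_adjoint A $$ (i, j) = cnj (A $$ (j, i))"
    if "A \<in> carrier_mat d d" "i < d" "j < d" for i j
    using that by (auto simp: mat_adjoint_def mat_of_rows_def)
  show ?thesis
  proof (cases "A \<in> carrier_mat d d")
    case True
    have "mat_adjoint A = A \<longleftrightarrow> (\<forall>i<d. \<forall>j<d. mat_adjoint A $$ (j, i) = A $$ (j, i))"
      using dims[OF True] True by (auto intro!: eq_matI)
    also have "\<dots> \<longleftrightarrow> (\<forall>i<d. \<forall>j<d. A $$ (j, i) = cnj (A $$ (i, j)))"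
      using entry[OF True] by metis
    finally show ?thesis using True by (simp add: hermitian_mats_def)
  qed (simp add: hermitian_mats_def)
qed

lemma hermitian_mats_diff:
  assumes "A \<in> hermitian_mats d" and "B \<in> hermitian_mats d"
  shows "A - B \<in> hermitian_mats d"
proof -
  have "(A - B) $$ (j, i) = cnj ((A - B) $$ (i, j))" if "i < d" "j < d" for i j
  proof -
    have "A $$ (j, i) = cnj (A $$ (i, j))" "B $$ (j, i) = cnj (B $$ (i, j))"
      "A \<in> carrier_mat d d" "B \<in> carrier_mat d d"
      using assms that unfolding hermitian_mats_iff by blast+
    then show ?thesis using that by simp
  qed
  then show ?thesis
    using assms unfolding hermitian_mats_iff by (blast intro: minus_carrier_mat)
qed

lemma quadratic_form_entries:
  assumes "A \<in> carrier_mat d d" and "v \<in> carrier_vec d"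
  shows "(A *\<^sub>v v) \<bullet>c v = (\<Sum>i<d. \<Sum>j<d. cnj (v $ i) * v $ j * A $$ (i, j))"
  using assms
  by (auto simp: scalar_prod_def lessThan_atLeast0 sum_distrib_left sum_distrib_right mult_ac
      intro!: sum.cong)

lemma closed_nonneg_complex: "closed {w::complex. 0 \<le> w}"
proof -
  have "{w::complex. 0 \<le> w} = {w. 0 \<le> Re w} \<inter> {w. Im w = 0}"
    by (auto simp: less_eq_complex_def)
  moreover have "closed {w. 0 \<le> Re w}" "closed {w. Im w = 0}"
    by (intro closed_Collect_le closed_Collect_eq continuous_intros)+
  ultimately show ?thesis by auto
qed

text \<open>Dense entries suffice because the form depends continuously on them. The test vectors are
  extensional, so that there are only countably many of them when \<open>D\<close> is countable.\<close>

lemma quadratic_form_nonneg_dense: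
  fixes N :: "nat \<Rightarrow> nat \<Rightarrow> complex" and v :: "nat \<Rightarrow> complex"
  assumes dense: "closure D = UNIV"
    and nonneg: "\<And>u. u \<in> {..<d} \<rightarrow>\<^sub>E D \<Longrightarrow> 0 \<le> (\<Sum>i<d. \<Sum>j<d. cnj (u i) * u j * N i j)"
  shows "0 \<le> (\<Sum>i<d. \<Sum>j<d. cnj (v i) * v j * N i j)"
proof -
  have "\<forall>i. \<exists>u. (\<forall>n. u n \<in> D) \<and> u \<longlonglongrightarrow> v i"
    using dense by (auto simp flip: closure_sequential)
  then obtain u where u: "\<And>i n. u i n \<in> D" "\<And>i. u i \<longlonglongrightarrow> v i" by metis
  have lim: "(\<lambda>n. \<Sum>i<d. \<Sum>j<d. cnj (u i n) * u j n * N i j)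
      \<longlonglongrightarrow> (\<Sum>i<d. \<Sum>j<d. cnj (v i) * v j * N i j)"
    by (intro tendsto_intros u)
  have "(\<Sum>i<d. \<Sum>j<d. cnj (u i n) * u j n * N i j) \<in> {w. 0 \<le> w}" for n
  proof -
    have "0 \<le> (\<Sum>i<d. \<Sum>j<d. cnj (restrict (\<lambda>i. u i n) {..<d} i)
        * restrict (\<lambda>i. u i n) {..<d} j * N i j)"
      by (rule nonneg) (simp only: restrict_PiE, simp add: u(1))
    then show ?thesis by simp
  qed
  then show ?thesis
    using closed_sequentially[OF closed_nonneg_complex _ lim] by blast
qed


section \<open>Symmetric bilinear forms that commute with conjugation\<close>

text \<open>\<open>\<Gamma>\<close>, \<open>\<Gamma>\<^sub>2\<close> and \<open>c \<Gamma>\<^sub>2 - \<Gamma>\<close> at a fixed point are all instances. The first two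
  give the Hermitian property of the two sides of the matrix inequality, the third gives
  positivity of their difference.\<close>

locale conj_symmetric_form =
  fixes V :: "('a \<Rightarrow> complex) set" and B :: "('a \<Rightarrow> complex) \<Rightarrow> ('a \<Rightarrow> complex) \<Rightarrow> complex"
  assumes V_zero: "(\<lambda>_. 0) \<in> V"
    and V_add: "\<And>f g. f \<in> V \<Longrightarrow> g \<in> V \<Longrightarrow> (\<lambda>x. f x + g x) \<in> V"
    and V_scale: "\<And>f a. f \<in> V \<Longrightarrow> (\<lambda>x. a * f x) \<in> V"
    and V_cnj: "\<And>f. f \<in> V \<Longrightarrow> (\<lambda>x. cnj (f x)) \<in> V"
    and B_sym: "\<And>f g. B f g = B g f"
    and B_add_left: "\<And>f f' g. f \<in> V \<Longrightarrow> f' \<in> V \<Longrightarrow> g \<in> V \<Longrightarrow>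
      B (\<lambda>x. f x + f' x) g = B f g + B f' g"
    and B_scale_left: "\<And>f g a. f \<in> V \<Longrightarrow> g \<in> V \<Longrightarrow> B (\<lambda>x. a * f x) g = a * B f g"
    and B_cnj: "\<And>f g. f \<in> V \<Longrightarrow> g \<in> V \<Longrightarrow>
      B (\<lambda>x. cnj (f x)) (\<lambda>x. cnj (g x)) = cnj (B f g)"
begin

lemma V_sum: "(\<And>i. i \<in> I \<Longrightarrow> f i \<in> V) \<Longrightarrow> (\<lambda>x. \<Sum>i\<in>I. f i x) \<in> V"
  by (induction I rule: infinite_finite_induct) (auto intro: V_zero V_add)

lemma B_zero_left: "g \<in> V \<Longrightarrow> B (\<lambda>_. 0) g = 0"
  using B_scale_left[of "\<lambda>_. 0" g 0] V_zero by simp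

lemma B_sum_left:
  assumes "\<And>i. i \<in> I \<Longrightarrow> f i \<in> V" and "g \<in> V"
  shows "B (\<lambda>x. \<Sum>i\<in>I. a i * f i x) g = (\<Sum>i\<in>I. a i * B (f i) g)"
  using assms(1)
proof (induction I rule: infinite_finite_induct)
  case (insert i I)
  then show ?case
    using assms(2) by (simp add: B_add_left B_scale_left V_scale V_sum)
qed (use assms(2) in \<open>auto simp: B_zero_left\<close>)

lemma B_sum_right:
  assumes "\<And>i. i \<in> I \<Longrightarrow> f i \<in> V" and "g \<in> V"
  shows "B g (\<lambda>x. \<Sum>i\<in>I. a i * f i x) = (\<Sum>i\<in>I. a i * B g (f i))"
  using B_sum_left[of I f g a] assms by (simp add: B_sym)

lemma Re_Im_in_V:
  assumes "f \<in> V"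
  shows "(\<lambda>x. complex_of_real (Re (f x))) \<in> V" "(\<lambda>x. complex_of_real (Im (f x))) \<in> V"
proof -
  have "(\<lambda>x. 1/2 * f x + 1/2 * cnj (f x)) \<in> V"
    by (intro V_add V_scale V_cnj assms)
  moreover have "(\<lambda>x. - (\<i>/2) * f x + \<i>/2 * cnj (f x)) \<in> V"
    by (intro V_add V_scale V_cnj assms)
  moreover have "1/2 * w + 1/2 * cnj w = complex_of_real (Re w)"
    "- (\<i>/2) * w + \<i>/2 * cnj w = complex_of_real (Im w)" for w
    by (auto simp: complex_eq_iff)
  ultimately show "(\<lambda>x. complex_of_real (Re (f x))) \<in> V"
    "(\<lambda>x. complex_of_real (Im (f x))) \<in> V"
    by simp_all
qed

text \<open>With \<open>g = p + \<i> q\<close>, the cross terms \<open>\<i> B(p, q) - \<i> B(q, p)\<close> cancel by symmetry.\<close>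

lemma B_cnj_self:
  assumes "g \<in> V"
  shows "B (\<lambda>x. cnj (g x)) g =
    B (\<lambda>x. complex_of_real (Re (g x))) (\<lambda>x. complex_of_real (Re (g x))) +
    B (\<lambda>x. complex_of_real (Im (g x))) (\<lambda>x. complex_of_real (Im (g x)))"
proof -
  define p q where "p = (\<lambda>x. complex_of_real (Re (g x)))" "q = (\<lambda>x. complex_of_real (Im (g x)))"
  have V: "p \<in> V" "q \<in> V" unfolding p_q_def by (rule Re_Im_in_V[OF assms])+
  have g: "g = (\<lambda>x. p x + \<i> * q x)" and cg: "(\<lambda>x. cnj (g x)) = (\<lambda>x. p x + (-\<i>) * q x)"
    by (auto simp: p_q_def complex_eq_iff fun_eq_iff)
  have left: "B (\<lambda>x. p x + a * q x) h = B p h + a * B q h" if "h \<in> V" for a h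
    using that V by (simp add: B_add_left B_scale_left V_scale)
  have right: "B h (\<lambda>x. p x + a * q x) = B h p + a * B h q" if "h \<in> V" for a h
    using left[OF that] by (simp add: B_sym)
  have "B (\<lambda>x. cnj (g x)) g = B (\<lambda>x. p x + (-\<i>) * q x) (\<lambda>x. p x + \<i> * q x)"
    by (simp only: cg) (simp only: g)
  also have "\<dots> = B p p + B q q"
    using V B_sym[of q p]
    by (subst left)
      (auto simp: right V_add V_scale simp del: mult_minus_left, simp add: algebra_simps)
  finally show ?thesis by (simp add: p_q_def)
qed

text \<open>Conjugation turns \<open>B(F\<^sub>i\<^sub>k, F\<^sub>k\<^sub>j)\<close> into \<open>B(F\<^sub>k\<^sub>i, F\<^sub>j\<^sub>k)\<close>, and symmetry of \<open>B\<close> exchanges the factors.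
  So a matrix with entries \<open>\<Sum>k. B(F\<^sub>i\<^sub>k, F\<^sub>k\<^sub>j)\<close> is Hermitian.\<close>

lemma hermitian_square:
  assumes "\<And>i k. i < d \<Longrightarrow> k < d \<Longrightarrow> F i k \<in> V"
    and "\<And>i k. i < d \<Longrightarrow> k < d \<Longrightarrow> F k i = (\<lambda>x. cnj (F i k x))"
    and "i < d" "j < d"
  shows "(\<Sum>k<d. B (F j k) (F k i)) = cnj (\<Sum>k<d. B (F i k) (F k j))"
  unfolding cnj_sum
proof (rule sum.cong)
  fix k assume "k \<in> {..<d}"
  then have k: "k < d" by simp
  have "B (F k i) (F j k) = B (\<lambda>x. cnj (F i k x)) (\<lambda>x. cnj (F k j x))"
    using assms(2)[OF \<open>i < d\<close> k] assms(2)[OF k \<open>j < d\<close>] by (simp only:)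
  also have "\<dots> = cnj (B (F i k) (F k j))"
    by (intro B_cnj assms(1) k \<open>i < d\<close> \<open>j < d\<close>)
  finally show "B (F j k) (F k i) = cnj (B (F i k) (F k j))"
    by (simp only: B_sym[of "F j k"])
qed simp

text \<open>By bilinearity the left side is \<open>\<Sum>k. B(cnj g\<^sub>k, g\<^sub>k)\<close>, where \<open>g\<^sub>k\<close> are the entries of \<open>F v\<close>:
  the factor \<open>cnj (v i)\<close> joins \<open>F\<^sub>i\<^sub>k = cnj F\<^sub>k\<^sub>i\<close> in the first argument, and \<open>v j\<close> joins \<open>F\<^sub>k\<^sub>j\<close> in the
  second. Each summand then splits into the values of \<open>B\<close> on the real and the imaginary part of
  \<open>g\<^sub>k\<close>, which is what makes a hypothesis about real functions applicable.\<close>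

lemma quadratic_form_square:
  assumes V: "\<And>i k. i < d \<Longrightarrow> k < d \<Longrightarrow> F i k \<in> V"
    and herm: "\<And>i k. i < d \<Longrightarrow> k < d \<Longrightarrow> F k i = (\<lambda>x. cnj (F i k x))"
    and g_def: "g = (\<lambda>k x. \<Sum>j<d. v j * F k j x)"
  shows "(\<Sum>i<d. \<Sum>j<d. cnj (v i) * v j * (\<Sum>k<d. B (F i k) (F k j))) =
    (\<Sum>k<d. B (\<lambda>x. complex_of_real (Re (g k x))) (\<lambda>x. complex_of_real (Re (g k x))) +
           B (\<lambda>x. complex_of_real (Im (g k x))) (\<lambda>x. complex_of_real (Im (g k x))))"
proof -
  have gV: "g k \<in> V" if "k < d" for k
    unfolding g_def using that V by (intro V_sum V_scale) auto
  have step: "B (\<lambda>x. cnj (g k x)) (g k) =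
      (\<Sum>i<d. \<Sum>j<d. cnj (v i) * v j * B (F i k) (F k j))" if k: "k < d" for k
  proof -
    have cnj_g: "(\<lambda>x. cnj (g k x)) = (\<lambda>x. \<Sum>i<d. cnj (v i) * F i k x)"
    proof
      fix x
      have "cnj (F k i x) = F i k x" if "i < d" for i
        using herm[OF k that] by simp
      then show "cnj (g k x) = (\<Sum>i<d. cnj (v i) * F i k x)"
        by (simp add: g_def)
    qed
    have "B (\<lambda>x. cnj (g k x)) (g k) = (\<Sum>i<d. cnj (v i) * B (F i k) (g k))"
      unfolding cnj_g using V k gV[OF k] by (intro B_sum_left) auto
    also have "\<dots> = (\<Sum>i<d. cnj (v i) * (\<Sum>j<d. v j * B (F i k) (F k j)))"
    proof (rule sum.cong)
      fix i assume "i \<in> {..<d}"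
      then show "cnj (v i) * B (F i k) (g k) = cnj (v i) * (\<Sum>j<d. v j * B (F i k) (F k j))"
        unfolding g_def using V k by (subst B_sum_right) auto
    qed simp
    finally show ?thesis by (simp add: sum_distrib_left mult_ac)
  qed
  have "(\<Sum>i<d. \<Sum>j<d. cnj (v i) * v j * (\<Sum>k<d. B (F i k) (F k j)))
      = (\<Sum>i<d. \<Sum>j<d. \<Sum>k<d. cnj (v i) * v j * B (F i k) (F k j))"
    by (simp add: sum_distrib_left)
  also have "\<dots> = (\<Sum>i<d. \<Sum>k<d. \<Sum>j<d. cnj (v i) * v j * B (F i k) (F k j))"
    by (intro sum.cong refl sum.swap)
  also have "\<dots> = (\<Sum>k<d. \<Sum>i<d. \<Sum>j<d. cnj (v i) * v j * B (F i k) (F k j))"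
    by (rule sum.swap)
  also have "\<dots> = (\<Sum>k<d. B (\<lambda>x. cnj (g k x)) (g k))"
    by (simp add: step)
  finally show ?thesis using gV by (simp add: B_cnj_self)
qed

end


section \<open>Carre du champ forms on complex-valued suitable functions\<close>

definition complex_class :: "('a \<Rightarrow> real) set \<Rightarrow> ('a \<Rightarrow> complex) set" where
  "complex_class S = {f. (\<lambda>z. Re (f z)) \<in> S \<and> (\<lambda>z. Im (f z)) \<in> S}"

definition complex_carre_du_champ ::
    "('a \<Rightarrow> 'w measure) \<Rightarrow> (real \<Rightarrow> 'w \<Rightarrow> 'a)
      \<Rightarrow> ('a \<Rightarrow> complex) \<Rightarrow> ('a \<Rightarrow> complex) \<Rightarrow> 'a \<Rightarrow> complex" where
  "complex_carre_du_champ Pr Z f g z =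
     1/2 * (gen Pr Z (\<lambda>x. f x * g x) z - f z * gen Pr Z g z - gen Pr Z f z * g z)"

definition complex_carre_du_champ2 ::
    "('a \<Rightarrow> 'w measure) \<Rightarrow> (real \<Rightarrow> 'w \<Rightarrow> 'a)
      \<Rightarrow> ('a \<Rightarrow> complex) \<Rightarrow> ('a \<Rightarrow> complex) \<Rightarrow> 'a \<Rightarrow> complex" where
  "complex_carre_du_champ2 Pr Z f g z =
     1/2 * (gen Pr Z (complex_carre_du_champ Pr Z f g) z
            - complex_carre_du_champ Pr Z f (gen Pr Z g) z
            - complex_carre_du_champ Pr Z (gen Pr Z f) g z)"

context suitable_class
begin

abbreviation "\<G> \<equiv> complex_carre_du_champ Pr Z"
abbreviation "\<G>\<^sub>2 \<equiv> complex_carre_du_champ2 Pr Z"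
abbreviation "\<C> \<equiv> complex_class S"

lemma suitable_minus: "f \<in> S \<Longrightarrow> (\<lambda>z. - f z) \<in> S"
  using suitable_mult[OF suitable_const[of "-1"]] by simp

lemma suitable_diff: "f \<in> S \<Longrightarrow> g \<in> S \<Longrightarrow> (\<lambda>z. f z - g z) \<in> S"
  using suitable_add[OF _ suitable_minus, of f g] by simp

lemma complex_const: "(\<lambda>_. a) \<in> \<C>"
  by (simp add: complex_class_def suitable_const)

lemma complex_add: "f \<in> \<C> \<Longrightarrow> g \<in> \<C> \<Longrightarrow> (\<lambda>z. f z + g z) \<in> \<C>"
  by (simp add: complex_class_def suitable_add)

lemma complex_diff: "f \<in> \<C> \<Longrightarrow> g \<in> \<C> \<Longrightarrow> (\<lambda>z. f z - g z) \<in> \<C>"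
  by (simp add: complex_class_def suitable_diff)

lemma complex_mult: "f \<in> \<C> \<Longrightarrow> g \<in> \<C> \<Longrightarrow> (\<lambda>z. f z * g z) \<in> \<C>"
  by (simp add: complex_class_def suitable_add suitable_mult suitable_diff)

lemma complex_scale: "f \<in> \<C> \<Longrightarrow> (\<lambda>z. a * f z) \<in> \<C>"
  by (intro complex_mult complex_const)

lemma complex_cnj: "f \<in> \<C> \<Longrightarrow> (\<lambda>z. cnj (f z)) \<in> \<C>"
  by (simp add: complex_class_def suitable_minus)

lemma complex_of_suitable: "f \<in> S \<Longrightarrow> (\<lambda>z. complex_of_real (f z)) \<in> \<C>"
  by (simp add: complex_class_def suitable_const)

lemma complex_integrable:
  assumes "f \<in> \<C>" "0 \<le> t"
  shows "integrable (Pr z) (\<lambda>\<omega>. f (Z t \<omega>))"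
proof -
  have "integrable (Pr z) (\<lambda>\<omega>. Re (f (Z t \<omega>)))" "integrable (Pr z) (\<lambda>\<omega>. Im (f (Z t \<omega>)))"
    using assms suitable_integrable[of "\<lambda>z. Re (f z)"] suitable_integrable[of "\<lambda>z. Im (f z)"]
    by (auto simp: complex_class_def)
  then have "integrable (Pr z)
      (\<lambda>\<omega>. complex_of_real (Re (f (Z t \<omega>))) + \<i> * complex_of_real (Im (f (Z t \<omega>))))"
    by (intro Bochner_Integration.integrable_add integrable_mult_right integrable_of_real)
  then show ?thesis by (simp flip: complex_eq)
qed

lemma gen_eqI:
  assumes "((\<lambda>t. (semigroup_op Pr Z t f z - f z) /\<^sub>R t) \<longlongrightarrow> l) (at_right 0)"
  shows "gen Pr Z f z = l"
  unfolding gen_def by (rule tendsto_Lim[OF _ assms]) simp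

text \<open>For complex functions the difference quotients converge because both parts converge.
  Integrability, which lets the expectation commute with taking parts, is available for \<open>t \<ge> 0\<close>
  only, and the limit from the right sees no other times.\<close>

lemma complex_generator_limit_parts:
  assumes "f \<in> \<C>"
  shows "((\<lambda>t. (semigroup_op Pr Z t f z - f z) /\<^sub>R t)
    \<longlongrightarrow> Complex (gen Pr Z (\<lambda>x. Re (f x)) z) (gen Pr Z (\<lambda>x. Im (f x)) z)) (at_right 0)"
proof -
  have S: "(\<lambda>x. Re (f x)) \<in> S" "(\<lambda>x. Im (f x)) \<in> S"
    using assms by (auto simp: complex_class_def)
  have "\<forall>\<^sub>F t in at_right 0.
      Complex ((semigroup_op Pr Z t (\<lambda>x. Re (f x)) z - Re (f z)) /\<^sub>R t)
              ((semigroup_op Pr Z t (\<lambda>x. Im (f x)) z - Im (f z)) /\<^sub>R t)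
      = (semigroup_op Pr Z t f z - f z) /\<^sub>R t"
    using eventually_at_right_less[of 0]
  proof eventually_elim
    case (elim t)
    then show ?case
      using complex_integrable[OF assms, of t z] by (simp add: semigroup_op_def complex_eq_iff)
  qed
  then show ?thesis
    by (rule Lim_transform_eventually[rotated]) (intro tendsto_Complex generator_limit S)
qed

lemma complex_gen_parts:
  "f \<in> \<C> \<Longrightarrow> gen Pr Z f z = Complex (gen Pr Z (\<lambda>x. Re (f x)) z) (gen Pr Z (\<lambda>x. Im (f x)) z)"
  by (intro gen_eqI complex_generator_limit_parts)

lemma complex_gen_closed: "f \<in> \<C> \<Longrightarrow> gen Pr Z f \<in> \<C>"
  by (simp add: complex_class_def complex_gen_parts suitable_gen)

lemma complex_generator_limit:
  "f \<in> \<C> \<Longrightarrow>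
     ((\<lambda>t. (semigroup_op Pr Z t f z - f z) /\<^sub>R t) \<longlongrightarrow> gen Pr Z f z) (at_right 0)"
  using complex_generator_limit_parts by (simp add: complex_gen_parts)

lemma gen_of_real:
  assumes "f \<in> S"
  shows "gen Pr Z (\<lambda>x. complex_of_real (f x)) z = complex_of_real (gen Pr Z f z)"
proof -
  have "((\<lambda>t. of_real ((semigroup_op Pr Z t f z - f z) /\<^sub>R t)) \<longlongrightarrow> complex_of_real (gen Pr Z f z))
      (at_right 0)"
    by (intro tendsto_of_real generator_limit assms)
  then show ?thesis
    by (intro gen_eqI) (simp add: semigroup_op_def scaleR_conv_of_real)
qed

lemma gen_add:
  assumes "f \<in> \<C>" "g \<in> \<C>"
  shows "gen Pr Z (\<lambda>x. f x + g x) z = gen Pr Z f z + gen Pr Z g z"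
proof (rule gen_eqI)
  have "\<forall>\<^sub>F t in at_right 0.
      (semigroup_op Pr Z t f z - f z) /\<^sub>R t + (semigroup_op Pr Z t g z - g z) /\<^sub>R t
      = (semigroup_op Pr Z t (\<lambda>x. f x + g x) z - (f z + g z)) /\<^sub>R t"
    using eventually_at_right_less[of 0]
  proof eventually_elim
    case (elim t)
    then show ?case
      using complex_integrable[OF assms(1), of t z] complex_integrable[OF assms(2), of t z]
      by (simp add: semigroup_op_def algebra_simps)
  qed
  then show "((\<lambda>t. (semigroup_op Pr Z t (\<lambda>x. f x + g x) z - (f z + g z)) /\<^sub>R t)
      \<longlongrightarrow> gen Pr Z f z + gen Pr Z g z) (at_right 0)"
    by (rule Lim_transform_eventually[rotated])
      (intro tendsto_add complex_generator_limit assms)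
qed

lemma gen_scale:
  assumes "f \<in> \<C>"
  shows "gen Pr Z (\<lambda>x. a * f x) z = a * gen Pr Z f z"
proof (rule gen_eqI)
  have "((\<lambda>t. a * ((semigroup_op Pr Z t f z - f z) /\<^sub>R t)) \<longlongrightarrow> a * gen Pr Z f z) (at_right 0)"
    by (intro tendsto_mult tendsto_const complex_generator_limit assms)
  then show "((\<lambda>t. (semigroup_op Pr Z t (\<lambda>x. a * f x) z - a * f z) /\<^sub>R t)
      \<longlongrightarrow> a * gen Pr Z f z) (at_right 0)"
    by (simp add: semigroup_op_def scaleR_conv_of_real algebra_simps)
qed

lemma gen_cnj:
  assumes "f \<in> \<C>"
  shows "gen Pr Z (\<lambda>x. cnj (f x)) z = cnj (gen Pr Z f z)"
proof (rule gen_eqI)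
  have "((\<lambda>t. cnj ((semigroup_op Pr Z t f z - f z) /\<^sub>R t)) \<longlongrightarrow> cnj (gen Pr Z f z)) (at_right 0)"
    by (intro tendsto_cnj complex_generator_limit assms)
  then show "((\<lambda>t. (semigroup_op Pr Z t (\<lambda>x. cnj (f x)) z - cnj (f z)) /\<^sub>R t)
      \<longlongrightarrow> cnj (gen Pr Z f z)) (at_right 0)"
    by (simp add: semigroup_op_def scaleR_conv_of_real)
qed

lemma gen_sum:
  assumes "\<And>i. i \<in> I \<Longrightarrow> f i \<in> \<C>"
  shows "gen Pr Z (\<lambda>x. \<Sum>i\<in>I. f i x) z = (\<Sum>i\<in>I. gen Pr Z (f i) z)"
proof -
  have zero: "gen Pr Z (\<lambda>_. 0::complex) z = 0"
    using gen_scale[of "\<lambda>_. 0" 0] complex_const by simp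
  have "(\<lambda>x. \<Sum>i\<in>I. f i x) \<in> \<C> \<and> gen Pr Z (\<lambda>x. \<Sum>i\<in>I. f i x) z = (\<Sum>i\<in>I. gen Pr Z (f i) z)"
    using assms
    by (induction I rule: infinite_finite_induct)
      (auto simp: zero gen_add intro: complex_const complex_add)
  then show ?thesis ..
qed

lemma complex_carre_du_champ_closed:
  assumes "f \<in> \<C>" "g \<in> \<C>"
  shows "\<G> f g \<in> \<C>"
proof -
  have "\<G> f g = (\<lambda>z. 1/2 * (gen Pr Z (\<lambda>x. f x * g x) z - f z * gen Pr Z g z - gen Pr Z f z * g z))"
    by (simp add: complex_carre_du_champ_def fun_eq_iff)
  then show ?thesis
    using assms
    by (simp only:) (intro complex_scale complex_diff complex_mult complex_gen_closed)
qed

lemma complex_carre_du_champ_sym: "\<G> f g z = \<G> g f z"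
  by (simp add: complex_carre_du_champ_def mult.commute)

lemma complex_carre_du_champ_form: "conj_symmetric_form \<C> (\<lambda>f g. \<G> f g z)"
proof
  fix f f' g :: "'a \<Rightarrow> complex" and a :: complex
  assume V: "f \<in> \<C>" "g \<in> \<C>"
  show "\<G> (\<lambda>x. a * f x) g z = a * \<G> f g z"
    using gen_scale[OF V(1), of a z] gen_scale[OF complex_mult[OF V], of a z]
    unfolding complex_carre_du_champ_def
    by (simp only: mult.assoc) (simp add: right_diff_distrib mult.left_commute)
  show "\<G> (\<lambda>x. cnj (f x)) (\<lambda>x. cnj (g x)) z = cnj (\<G> f g z)"
    using gen_cnj[OF V(1), of z] gen_cnj[OF V(2), of z] gen_cnj[OF complex_mult[OF V], of z]
    by (simp add: complex_carre_du_champ_def)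
  assume V': "f' \<in> \<C>"
  show "\<G> (\<lambda>x. f x + f' x) g z = \<G> f g z + \<G> f' g z"
    using gen_add[OF V(1) V', of z] gen_add[OF complex_mult[OF V] complex_mult[OF V' V(2)], of z]
    unfolding complex_carre_du_champ_def by (simp only: distrib_right) (simp add: field_simps)
qed (simp_all add: complex_const complex_add complex_scale complex_cnj complex_carre_du_champ_sym)

lemma complex_carre_du_champ2_form: "conj_symmetric_form \<C> (\<lambda>f g. \<G>\<^sub>2 f g z)"
proof
  fix f f' g :: "'a \<Rightarrow> complex" and a :: complex
  interpret B: conj_symmetric_form \<C> "\<lambda>f g. \<G> f g z" for z by (rule complex_carre_du_champ_form)
  show "\<G>\<^sub>2 f g z = \<G>\<^sub>2 g f z"
  proof -
    have "\<G> g f = \<G> f g" using complex_carre_du_champ_sym by blast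
    then show ?thesis
      using complex_carre_du_champ_sym[of g "gen Pr Z f" z]
        complex_carre_du_champ_sym[of "gen Pr Z g" f z]
      by (simp add: complex_carre_du_champ2_def)
  qed
  assume V: "f \<in> \<C>" "g \<in> \<C>"
  note G = complex_carre_du_champ_closed[OF V]
    complex_gen_closed[OF V(1)] complex_gen_closed[OF V(2)]
  have "\<G> (\<lambda>x. a * f x) g = (\<lambda>z. a * \<G> f g z)"
    using V by (simp add: B.B_scale_left fun_eq_iff)
  moreover have "gen Pr Z (\<lambda>x. a * f x) = (\<lambda>z. a * gen Pr Z f z)"
    using V by (simp add: gen_scale fun_eq_iff)
  ultimately show "\<G>\<^sub>2 (\<lambda>x. a * f x) g z = a * \<G>\<^sub>2 f g z"
    using V G by (simp add: complex_carre_du_champ2_def gen_scale B.B_scale_left algebra_simps)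
  have "\<G> (\<lambda>x. cnj (f x)) (\<lambda>x. cnj (g x)) = (\<lambda>z. cnj (\<G> f g z))"
    using V by (simp add: B.B_cnj fun_eq_iff)
  moreover have "gen Pr Z (\<lambda>x. cnj (h x)) = (\<lambda>z. cnj (gen Pr Z h z))" if "h \<in> \<C>" for h
    using that by (simp add: gen_cnj fun_eq_iff)
  ultimately show "\<G>\<^sub>2 (\<lambda>x. cnj (f x)) (\<lambda>x. cnj (g x)) z = cnj (\<G>\<^sub>2 f g z)"
    using V G by (simp add: complex_carre_du_champ2_def B.B_cnj)
  assume V': "f' \<in> \<C>"
  have "\<G> (\<lambda>x. f x + f' x) g = (\<lambda>z. \<G> f g z + \<G> f' g z)"
    using V V' by (simp add: B.B_add_left fun_eq_iff)
  moreover have "gen Pr Z (\<lambda>x. f x + f' x) = (\<lambda>z. gen Pr Z f z + gen Pr Z f' z)"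
    using V V' by (simp add: gen_add fun_eq_iff)
  ultimately show "\<G>\<^sub>2 (\<lambda>x. f x + f' x) g z = \<G>\<^sub>2 f g z + \<G>\<^sub>2 f' g z"
    using V V' G complex_carre_du_champ_closed[OF V' V(2)] complex_gen_closed[OF V']
    by (simp add: complex_carre_du_champ2_def gen_add B.B_add_left algebra_simps)
qed (simp_all add: complex_const complex_add complex_scale complex_cnj)

lemma complex_carre_du_champ_of_real:
  assumes "f \<in> S" "g \<in> S"
  shows "\<G> (\<lambda>x. complex_of_real (f x)) (\<lambda>x. complex_of_real (g x)) z
    = complex_of_real (carre_du_champ Pr Z f g z)"
  using assms gen_of_real[OF suitable_mult[OF assms], of z]
  by (simp add: complex_carre_du_champ_def carre_du_champ_def gen_of_real)

lemma suitable_carre_du_champ: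
  assumes "f \<in> S" "g \<in> S"
  shows "carre_du_champ Pr Z f g \<in> S"
  using assms
    complex_carre_du_champ_closed[OF complex_of_suitable[OF assms(1)] complex_of_suitable[OF assms(2)]]
  by (simp add: complex_class_def complex_carre_du_champ_of_real)

lemma complex_carre_du_champ2_of_real:
  assumes "f \<in> S" "g \<in> S"
  shows "\<G>\<^sub>2 (\<lambda>x. complex_of_real (f x)) (\<lambda>x. complex_of_real (g x)) z
    = complex_of_real (carre_du_champ2 Pr Z f g z)"
proof -
  have "\<G> (\<lambda>x. complex_of_real (f x)) (\<lambda>x. complex_of_real (g x))
      = (\<lambda>z. complex_of_real (carre_du_champ Pr Z f g z))"
    using assms by (simp add: complex_carre_du_champ_of_real fun_eq_iff)
  moreover have "gen Pr Z (\<lambda>x. complex_of_real (h x)) = (\<lambda>z. complex_of_real (gen Pr Z h z))"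
    if "h \<in> S" for h
    using that by (simp add: gen_of_real fun_eq_iff)
  ultimately show ?thesis
    using assms suitable_gen[of f] suitable_gen[of g] suitable_carre_du_champ[OF assms]
    by (simp add: complex_carre_du_champ2_def carre_du_champ2_def complex_carre_du_champ_of_real)
qed


section \<open>The matrix operators by entries\<close>

lemma gen_mat_entry:
  "i < d \<Longrightarrow> j < d \<Longrightarrow> gen_mat Pr Z d f z $$ (i, j) = gen Pr Z (\<lambda>x. f x $$ (i, j)) z"
  by (simp add: gen_mat_def semigroup_mat_def gen_def semigroup_op_def)

lemma gen_mat_carrier: "gen_mat Pr Z d f z \<in> carrier_mat d d"
  by (simp add: gen_mat_def)

lemma carre_du_champ_mat_carrier:
  assumes "\<And>x. g x \<in> carrier_mat d d"
  shows "carre_du_champ_mat Pr Z d f g z \<in> carrier_mat d d"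
  unfolding carre_du_champ_mat_def
  by (intro smult_carrier_mat minus_carrier_mat mult_carrier_mat[OF gen_mat_carrier] assms)

lemma carre_du_champ2_mat_carrier:
  assumes "\<And>x. g x \<in> carrier_mat d d"
  shows "carre_du_champ2_mat Pr Z d f g z \<in> carrier_mat d d"
  unfolding carre_du_champ2_mat_def
  by (intro smult_carrier_mat minus_carrier_mat carre_du_champ_mat_carrier assms)

text \<open>The right-hand sides defining \<open>\<Gamma>\<close> and \<open>\<Gamma>\<^sub>2\<close> on matrices both have this shape.\<close>

lemma half_diff_entry:
  fixes A B C :: "complex mat"
  assumes "A \<in> carrier_mat d d" "B \<in> carrier_mat d d" "C \<in> carrier_mat d d" "i < d" "j < d"
  shows "((1/2) \<cdot>\<^sub>m (A - B - C)) $$ (i, j) = 1/2 * (A $$ (i, j) - B $$ (i, j) - C $$ (i, j))"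
  using assms by simp

lemma mult_mat_entry:
  assumes "A \<in> carrier_mat d d" "B \<in> carrier_mat d d" "i < d" "j < d"
  shows "(A * B) $$ (i, j) = (\<Sum>k<d. A $$ (i, k) * B $$ (k, j))"
  using assms by (simp add: scalar_prod_def lessThan_atLeast0)

text \<open>By linearity of the generator, each of the three terms in the definition is a sum over
  the inner index \<open>k\<close> of a matrix product, and the summands combine to \<open>\<Gamma>(f\<^sub>i\<^sub>k, g\<^sub>k\<^sub>j)\<close>.\<close>

lemma carre_du_champ_mat_entry:
  assumes f: "\<And>z. f z \<in> carrier_mat d d" "\<And>i j. i < d \<Longrightarrow> j < d \<Longrightarrow> (\<lambda>x. f x $$ (i, j)) \<in> \<C>"
    and g: "\<And>z. g z \<in> carrier_mat d d" "\<And>i j. i < d \<Longrightarrow> j < d \<Longrightarrow> (\<lambda>x. g x $$ (i, j)) \<in> \<C>"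
    and "i < d" "j < d"
  shows "carre_du_champ_mat Pr Z d f g z $$ (i, j)
    = (\<Sum>k<d. \<G> (\<lambda>x. f x $$ (i, k)) (\<lambda>x. g x $$ (k, j)) z)"
proof -
  have "(\<lambda>x. (f x * g x) $$ (i, j)) = (\<lambda>x. \<Sum>k<d. f x $$ (i, k) * g x $$ (k, j))"
    using assms by (intro ext mult_mat_entry)
  then have "gen_mat Pr Z d (\<lambda>x. f x * g x) z $$ (i, j)
      = gen Pr Z (\<lambda>x. \<Sum>k<d. f x $$ (i, k) * g x $$ (k, j)) z"
    using assms by (simp only: gen_mat_entry)
  also have "\<dots> = (\<Sum>k<d. gen Pr Z (\<lambda>x. f x $$ (i, k) * g x $$ (k, j)) z)"
    using assms by (intro gen_sum complex_mult) auto
  finally have prod: "gen_mat Pr Z d (\<lambda>x. f x * g x) z $$ (i, j)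
      = (\<Sum>k<d. gen Pr Z (\<lambda>x. f x $$ (i, k) * g x $$ (k, j)) z)" .
  have "carre_du_champ_mat Pr Z d f g z $$ (i, j)
    = 1/2 * (gen_mat Pr Z d (\<lambda>x. f x * g x) z $$ (i, j)
        - (f z * gen_mat Pr Z d g z) $$ (i, j) - (gen_mat Pr Z d f z * g z) $$ (i, j))"
    unfolding carre_du_champ_mat_def
    by (intro half_diff_entry[where d = d] mult_carrier_mat[of _ d d] gen_mat_carrier assms)
  also have "\<dots> = (\<Sum>k<d. \<G> (\<lambda>x. f x $$ (i, k)) (\<lambda>x. g x $$ (k, j)) z)"
    using assms
      mult_mat_entry[OF f(1)[of z] gen_mat_carrier[of d g z] \<open>i < d\<close> \<open>j < d\<close>]
      mult_mat_entry[OF gen_mat_carrier[of d f z] g(1)[of z] \<open>i < d\<close> \<open>j < d\<close>]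
    unfolding prod
    by (simp add: gen_mat_entry complex_carre_du_champ_def sum_subtractf sum_divide_distrib
        diff_divide_distrib del: index_mult_mat)
  finally show ?thesis .
qed

text \<open>The functions \<open>L f\<close> and \<open>L g\<close> again have suitable entries, so the entry formula for \<open>\<Gamma>\<close> applies
  to all three terms of the definition of \<open>\<Gamma>\<^sub>2\<close>.\<close>

lemma carre_du_champ2_mat_entry:
  assumes f: "\<And>z. f z \<in> carrier_mat d d" "\<And>i j. i < d \<Longrightarrow> j < d \<Longrightarrow> (\<lambda>x. f x $$ (i, j)) \<in> \<C>"
    and g: "\<And>z. g z \<in> carrier_mat d d" "\<And>i j. i < d \<Longrightarrow> j < d \<Longrightarrow> (\<lambda>x. g x $$ (i, j)) \<in> \<C>"
    and ij: "i < d" "j < d"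
  shows "carre_du_champ2_mat Pr Z d f g z $$ (i, j)
    = (\<Sum>k<d. \<G>\<^sub>2 (\<lambda>x. f x $$ (i, k)) (\<lambda>x. g x $$ (k, j)) z)"
proof -
  have gen_entry: "(\<lambda>x. gen_mat Pr Z d h x $$ (i, j)) = gen Pr Z (\<lambda>x. h x $$ (i, j))"
    if "i < d" "j < d" for h i j
    using that by (simp add: gen_mat_entry fun_eq_iff)
  have gen_f: "\<And>i j. i < d \<Longrightarrow> j < d \<Longrightarrow> (\<lambda>x. gen_mat Pr Z d f x $$ (i, j)) \<in> \<C>"
    and gen_g: "\<And>i j. i < d \<Longrightarrow> j < d \<Longrightarrow> (\<lambda>x. gen_mat Pr Z d g x $$ (i, j)) \<in> \<C>"
    using f g by (simp_all add: gen_entry complex_gen_closed)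
  have "gen_mat Pr Z d (carre_du_champ_mat Pr Z d f g) z $$ (i, j)
      = gen Pr Z (\<lambda>z. \<Sum>k<d. \<G> (\<lambda>x. f x $$ (i, k)) (\<lambda>x. g x $$ (k, j)) z) z"
    using assms by (simp add: gen_mat_entry carre_du_champ_mat_entry)
  also have "\<dots> = (\<Sum>k<d. gen Pr Z (\<G> (\<lambda>x. f x $$ (i, k)) (\<lambda>x. g x $$ (k, j))) z)"
    using assms by (intro gen_sum complex_carre_du_champ_closed) auto
  finally have G1: "gen_mat Pr Z d (carre_du_champ_mat Pr Z d f g) z $$ (i, j)
      = (\<Sum>k<d. gen Pr Z (\<G> (\<lambda>x. f x $$ (i, k)) (\<lambda>x. g x $$ (k, j))) z)" .
  have G2: "carre_du_champ_mat Pr Z d f (gen_mat Pr Z d g) z $$ (i, j)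
      = (\<Sum>k<d. \<G> (\<lambda>x. f x $$ (i, k)) (gen Pr Z (\<lambda>x. g x $$ (k, j))) z)"
    using carre_du_champ_mat_entry[OF f gen_mat_carrier gen_g ij] ij by (simp add: gen_entry)
  have G3: "carre_du_champ_mat Pr Z d (gen_mat Pr Z d f) g z $$ (i, j)
      = (\<Sum>k<d. \<G> (gen Pr Z (\<lambda>x. f x $$ (i, k))) (\<lambda>x. g x $$ (k, j)) z)"
    using carre_du_champ_mat_entry[OF gen_mat_carrier gen_f g ij] ij by (simp add: gen_entry)
  have "carre_du_champ2_mat Pr Z d f g z $$ (i, j)
    = 1/2 * (gen_mat Pr Z d (carre_du_champ_mat Pr Z d f g) z $$ (i, j)
        - carre_du_champ_mat Pr Z d f (gen_mat Pr Z d g) z $$ (i, j)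
        - carre_du_champ_mat Pr Z d (gen_mat Pr Z d f) g z $$ (i, j))"
    unfolding carre_du_champ2_mat_def
    by (intro half_diff_entry[where d = d] carre_du_champ_mat_carrier gen_mat_carrier g ij)
  then show ?thesis
    unfolding G1 G2 G3
    by (simp add: complex_carre_du_champ2_def sum_subtractf sum_divide_distrib
        diff_divide_distrib)
qed

lemma suitable_mat_entries:
  assumes "f \<in> suitable_mat S d"
  shows "f z \<in> carrier_mat d d"
    and "i < d \<Longrightarrow> j < d \<Longrightarrow> (\<lambda>x. f x $$ (i, j)) \<in> \<C>"
    and "i < d \<Longrightarrow> j < d \<Longrightarrow> (\<lambda>x. f x $$ (j, i)) = (\<lambda>x. cnj (f x $$ (i, j)))"
proof -
  have herm: "f x \<in> hermitian_mats d" for x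
    using assms by (simp add: suitable_mat_def)
  then show "f z \<in> carrier_mat d d"
    by (simp add: hermitian_mats_def)
  show "i < d \<Longrightarrow> j < d \<Longrightarrow> (\<lambda>x. f x $$ (i, j)) \<in> \<C>"
    using assms by (simp add: suitable_mat_def complex_class_def)
  show "i < d \<Longrightarrow> j < d \<Longrightarrow> (\<lambda>x. f x $$ (j, i)) = (\<lambda>x. cnj (f x $$ (i, j)))"
    using herm unfolding hermitian_mats_iff by blast
qed


section \<open>Equivalence of the two criteria\<close>

lemma defect_form:
  "conj_symmetric_form \<C> (\<lambda>f g. complex_of_real c * \<G>\<^sub>2 f g z - \<G> f g z)"
proof -
  interpret B: conj_symmetric_form \<C> "\<lambda>f g. \<G> f g z" by (rule complex_carre_du_champ_form)
  interpret B2: conj_symmetric_form \<C> "\<lambda>f g. \<G>\<^sub>2 f g z" by (rule complex_carre_du_champ2_form)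
  show ?thesis
  proof
    fix f f' g :: "'a \<Rightarrow> complex" and a :: complex
    show "complex_of_real c * \<G>\<^sub>2 f g z - \<G> f g z = complex_of_real c * \<G>\<^sub>2 g f z - \<G> g f z"
      by (simp only: B.B_sym[of f g] B2.B_sym[of f g])
    assume V: "f \<in> \<C>" "g \<in> \<C>"
    show "complex_of_real c * \<G>\<^sub>2 (\<lambda>x. a * f x) g z - \<G> (\<lambda>x. a * f x) g z
        = a * (complex_of_real c * \<G>\<^sub>2 f g z - \<G> f g z)"
      using B.B_scale_left[OF V, of a] B2.B_scale_left[OF V, of a]
      by (simp only:) (simp add: right_diff_distrib mult.left_commute)
    show "complex_of_real c * \<G>\<^sub>2 (\<lambda>x. cnj (f x)) (\<lambda>x. cnj (g x)) z
          - \<G> (\<lambda>x. cnj (f x)) (\<lambda>x. cnj (g x)) z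
        = cnj (complex_of_real c * \<G>\<^sub>2 f g z - \<G> f g z)"
      using B.B_cnj[OF V] B2.B_cnj[OF V] by simp
    assume V': "f' \<in> \<C>"
    show "complex_of_real c * \<G>\<^sub>2 (\<lambda>x. f x + f' x) g z - \<G> (\<lambda>x. f x + f' x) g z
        = complex_of_real c * \<G>\<^sub>2 f g z - \<G> f g z
          + (complex_of_real c * \<G>\<^sub>2 f' g z - \<G> f' g z)"
      using B.B_add_left[OF V(1) V' V(2)] B2.B_add_left[OF V(1) V' V(2)]
      by (simp only:) (simp add: distrib_left)
  qed (simp_all only: B.V_zero B.V_add B.V_scale B.V_cnj)
qed

text \<open>The entries of the matrix defect are \<open>\<Sum>k. B(f\<^sub>i\<^sub>k, f\<^sub>k\<^sub>j)\<close> for the form \<open>B = c \<Gamma>\<^sub>2 - \<Gamma>\<close>, so its quadratic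
  form is a sum of values \<open>B(h, h)\<close> with \<open>h\<close> real, and these are the scalar defects \<open>Q(h)\<close>.\<close>

lemma defect_quadratic_form:
  fixes c :: real
  assumes f: "f \<in> suitable_mat S d"
  defines "Q \<equiv> \<lambda>h z. c * carre_du_champ2 Pr Z h h z - carre_du_champ Pr Z h h z"
    and "g \<equiv> \<lambda>v k x. \<Sum>j<d. v j * f x $$ (k, j)"
  shows "(\<Sum>i<d. \<Sum>j<d. cnj (v i) * v j *
      (complex_of_real c \<cdot>\<^sub>m carre_du_champ2_mat Pr Z d f f z
        - carre_du_champ_mat Pr Z d f f z) $$ (i, j))
    = complex_of_real (\<Sum>k<d. Q (\<lambda>x. Re (g v k x)) z + Q (\<lambda>x. Im (g v k x)) z)"
proof -
  note F = suitable_mat_entries[OF f]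
  define D where "D h = complex_of_real c * \<G>\<^sub>2 h h z - \<G> h h z" for h
  interpret B: conj_symmetric_form \<C> "\<lambda>f g. complex_of_real c * \<G>\<^sub>2 f g z - \<G> f g z"
    by (rule defect_form)
  have entry: "(complex_of_real c \<cdot>\<^sub>m carre_du_champ2_mat Pr Z d f f z
        - carre_du_champ_mat Pr Z d f f z) $$ (i, j)
      = (\<Sum>k<d. complex_of_real c * \<G>\<^sub>2 (\<lambda>x. f x $$ (i, k)) (\<lambda>x. f x $$ (k, j)) z
          - \<G> (\<lambda>x. f x $$ (i, k)) (\<lambda>x. f x $$ (k, j)) z)" if "i < d" "j < d" for i j
    using that carre_du_champ2_mat_carrier[of f d f z, OF F(1)]
      carre_du_champ_mat_carrier[of f d f z, OF F(1)]
    by (simp add: carre_du_champ_mat_entry carre_du_champ2_mat_entry F(1,2) sum_subtractf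
        sum_distrib_left)
  have g: "(\<lambda>x. Re (g v k x)) \<in> S" "(\<lambda>x. Im (g v k x)) \<in> S" if "k < d" for k
  proof -
    have "g v k \<in> \<C>"
      unfolding g_def using that by (intro B.V_sum complex_scale F(2)) auto
    then show "(\<lambda>x. Re (g v k x)) \<in> S" "(\<lambda>x. Im (g v k x)) \<in> S"
      by (simp_all add: complex_class_def)
  qed
  have "(\<Sum>i<d. \<Sum>j<d. cnj (v i) * v j *
      (complex_of_real c \<cdot>\<^sub>m carre_du_champ2_mat Pr Z d f f z
        - carre_du_champ_mat Pr Z d f f z) $$ (i, j))
    = (\<Sum>i<d. \<Sum>j<d. cnj (v i) * v j *
        (\<Sum>k<d. complex_of_real c * \<G>\<^sub>2 (\<lambda>x. f x $$ (i, k)) (\<lambda>x. f x $$ (k, j)) z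
          - \<G> (\<lambda>x. f x $$ (i, k)) (\<lambda>x. f x $$ (k, j)) z))"
    by (intro sum.cong refl) (simp only: entry lessThan_iff)
  also have "\<dots> = (\<Sum>k<d. D (\<lambda>x. complex_of_real (Re (g v k x)))
      + D (\<lambda>x. complex_of_real (Im (g v k x))))"
    unfolding D_def
    by (subst B.quadratic_form_square[where F = "\<lambda>i k x. f x $$ (i, k)" and g = "g v"])
      (auto simp: F(2) g_def intro: F(3))
  also have "\<dots> = (\<Sum>k<d. complex_of_real (Q (\<lambda>x. Re (g v k x)) z)
      + complex_of_real (Q (\<lambda>x. Im (g v k x)) z))"
    by (intro sum.cong refl)
      (simp add: g D_def Q_def complex_carre_du_champ_of_real complex_carre_du_champ2_of_real)
  finally show ?thesis by simp
qed

text \<open>For each \<open>v\<close> with entries in a countable dense set, the scalar criterion is applied to the real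
  and imaginary parts of the entries of \<open>f v\<close>. Only countably many functions occur, so a single
  null set serves them all.\<close>

lemma scalar_imp_matrix:
  assumes scalar: "\<And>h. h \<in> S \<Longrightarrow>
      AE z in \<mu>. carre_du_champ Pr Z h h z \<le> c * carre_du_champ2 Pr Z h h z"
    and f: "f \<in> suitable_mat S d"
  shows "AE z in \<mu>. loewner_le d (carre_du_champ_mat Pr Z d f f z)
      (complex_of_real c \<cdot>\<^sub>m carre_du_champ2_mat Pr Z d f f z)"
proof -
  note F = suitable_mat_entries[OF f]
  define A where "A z = complex_of_real c \<cdot>\<^sub>m carre_du_champ2_mat Pr Z d f f z
    - carre_du_champ_mat Pr Z d f f z" for z
  have herm: "carre_du_champ_mat Pr Z d f f z \<in> hermitian_mats d"
    "complex_of_real c \<cdot>\<^sub>m carre_du_champ2_mat Pr Z d f f z \<in> hermitian_mats d" for z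
  proof -
    interpret B: conj_symmetric_form \<C> "\<lambda>f g. \<G> f g z" by (rule complex_carre_du_champ_form)
    interpret B2: conj_symmetric_form \<C> "\<lambda>f g. \<G>\<^sub>2 f g z" by (rule complex_carre_du_champ2_form)
    show "carre_du_champ_mat Pr Z d f f z \<in> hermitian_mats d"
      unfolding hermitian_mats_iff
    proof (intro conjI allI impI)
      fix i j assume ij: "i < d" "j < d"
      show "carre_du_champ_mat Pr Z d f f z $$ (j, i)
          = cnj (carre_du_champ_mat Pr Z d f f z $$ (i, j))"
        using ij B.hermitian_square[where F = "\<lambda>i k x. f x $$ (i, k)", OF F(2,3) ij]
          carre_du_champ_mat_carrier[of f d f z, OF F(1)]
        by (simp add: carre_du_champ_mat_entry F(1,2) del: cnj_sum)
    qed (intro smult_carrier_mat carre_du_champ_mat_carrier F(1))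
    show "complex_of_real c \<cdot>\<^sub>m carre_du_champ2_mat Pr Z d f f z \<in> hermitian_mats d"
      unfolding hermitian_mats_iff
    proof (intro conjI allI impI)
      fix i j assume ij: "i < d" "j < d"
      show "(complex_of_real c \<cdot>\<^sub>m carre_du_champ2_mat Pr Z d f f z) $$ (j, i)
          = cnj ((complex_of_real c \<cdot>\<^sub>m carre_du_champ2_mat Pr Z d f f z) $$ (i, j))"
        using ij B2.hermitian_square[where F = "\<lambda>i k x. f x $$ (i, k)", OF F(2,3) ij]
          carre_du_champ2_mat_carrier[of f d f z, OF F(1)]
        by (simp add: carre_du_champ2_mat_entry F(1,2) del: cnj_sum)
    qed (intro smult_carrier_mat carre_du_champ2_mat_carrier F(1))
  qed
  then have herm_A: "A z \<in> hermitian_mats d" for z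
    unfolding A_def by (intro hermitian_mats_diff)
  obtain D :: "complex set" where D: "countable D"
    "\<And>X. open X \<Longrightarrow> X \<noteq> {} \<Longrightarrow> \<exists>w\<in>D. w \<in> X"
    using countable_dense_exists by blast
  then have dense: "closure D = UNIV"
    using D(2)[of "- closure D"] closure_subset[of D] by auto
  have "AE z in \<mu>. \<forall>v\<in>{..<d} \<rightarrow>\<^sub>E D. 0 \<le> (\<Sum>i<d. \<Sum>j<d. cnj (v i) * v j * A z $$ (i, j))"
  proof (rule AE_ball_countable')
    show "countable ({..<d} \<rightarrow>\<^sub>E D)" using D(1) by (intro countable_PiE) auto
    fix v :: "nat \<Rightarrow> complex"
    define g where "g k x = (\<Sum>j<d. v j * f x $$ (k, j))" for k x
    have "g k \<in> \<C>" if "k < d" for k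
    proof -
      interpret B: conj_symmetric_form \<C> "\<lambda>f g. \<G> f g z" for z
        by (rule complex_carre_du_champ_form)
      show ?thesis unfolding g_def using that by (intro B.V_sum complex_scale F(2)) auto
    qed
    then have "AE z in \<mu>. \<forall>k\<in>{..<d}.
        carre_du_champ Pr Z (\<lambda>x. Re (g k x)) (\<lambda>x. Re (g k x)) z
          \<le> c * carre_du_champ2 Pr Z (\<lambda>x. Re (g k x)) (\<lambda>x. Re (g k x)) z \<and>
        carre_du_champ Pr Z (\<lambda>x. Im (g k x)) (\<lambda>x. Im (g k x)) z
          \<le> c * carre_du_champ2 Pr Z (\<lambda>x. Im (g k x)) (\<lambda>x. Im (g k x)) z"
      by (intro AE_ball_countable' AE_conjI scalar) (auto simp: complex_class_def)
    then show "AE z in \<mu>. 0 \<le> (\<Sum>i<d. \<Sum>j<d. cnj (v i) * v j * A z $$ (i, j))"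
    proof eventually_elim
      case (elim z)
      show ?case
        unfolding A_def defect_quadratic_form[OF f]
        using elim by (auto simp: less_eq_complex_def g_def intro!: sum_nonneg add_nonneg_nonneg)
    qed
  qed
  then show ?thesis
  proof eventually_elim
    case (elim z)
    have "0 \<le> (A z *\<^sub>v v) \<bullet>c v" if "v \<in> carrier_vec d" for v
    proof -
      have "A z \<in> carrier_mat d d" using herm_A by (simp add: hermitian_mats_def)
      then show ?thesis
        using quadratic_form_nonneg_dense[OF dense, where N = "\<lambda>i j. A z $$ (i, j)"] elim that
        by (simp add: quadratic_form_entries)
    qed
    then show ?case
      using herm herm_A[of z] by (simp add: loewner_le_def psd_def A_def)
  qed
qed

text \<open>A suitable real function is a \<open>1 \<times> 1\<close> Hermitian matrix function, and testing against the unit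
  vector returns the scalar inequality.\<close>

lemma matrix_imp_scalar:
  assumes mat: "\<And>f. f \<in> suitable_mat S 1 \<Longrightarrow>
      AE z in \<mu>. loewner_le 1 (carre_du_champ_mat Pr Z 1 f f z)
        (complex_of_real c \<cdot>\<^sub>m carre_du_champ2_mat Pr Z 1 f f z)"
    and h: "h \<in> S"
  shows "AE z in \<mu>. carre_du_champ Pr Z h h z \<le> c * carre_du_champ2 Pr Z h h z"
proof -
  define f where "f x = Matrix.mat 1 1 (\<lambda>_. complex_of_real (h x))" for x
  have f: "f \<in> suitable_mat S 1"
    using h by (auto simp: suitable_mat_def f_def hermitian_mats_iff suitable_const)
  note F = suitable_mat_entries[OF f]
  have entry: "(\<lambda>x. f x $$ (0, 0)) = (\<lambda>x. complex_of_real (h x))"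
    by (simp add: f_def)
  show ?thesis
    using mat[OF f]
  proof eventually_elim
    case (elim z)
    define A where "A = complex_of_real c \<cdot>\<^sub>m carre_du_champ2_mat Pr Z 1 f f z
      - carre_du_champ_mat Pr Z 1 f f z"
    have A: "A \<in> carrier_mat 1 1" and nonneg: "0 \<le> (A *\<^sub>v vec 1 (\<lambda>_. 1)) \<bullet>c vec 1 (\<lambda>_. 1)"
      using elim by (auto simp: A_def loewner_le_def psd_def hermitian_mats_def)
    have "(A *\<^sub>v vec 1 (\<lambda>_. 1)) \<bullet>c vec 1 (\<lambda>_. 1) = A $$ (0, 0)"
      using quadratic_form_entries[OF A, of "vec 1 (\<lambda>_. 1)"] by simp
    also have "\<dots> = complex_of_real (c * carre_du_champ2 Pr Z h h z - carre_du_champ Pr Z h h z)"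
      using carre_du_champ_mat_carrier[of f 1 f z, OF F(1)]
        carre_du_champ2_mat_carrier[of f 1 f z, OF F(1)]
        carre_du_champ_mat_entry[OF F(1,2) F(1,2), of 0 0 z]
        carre_du_champ2_mat_entry[OF F(1,2) F(1,2), of 0 0 z] h
      by (simp add: A_def entry complex_carre_du_champ_of_real complex_carre_du_champ2_of_real)
    finally show ?case
      using nonneg by (simp add: less_eq_complex_def)
  qed
qed

end

theorem proposition2p6:
  fixes W :: "'w measure"
    and Pr :: "'a::polish_space \<Rightarrow> 'w measure"
    and Z :: "real \<Rightarrow> 'w \<Rightarrow> 'a"
    and \<mu> :: "'a measure"
    and S :: "('a \<Rightarrow> real) set"
    and c :: real
  assumes "suitable_class W Pr Z \<mu> S"
    and "c > 0"
  shows "(\<forall>f\<in>S. AE z in \<mu>. carre_du_champ Pr Z f f z \<le> c * carre_du_champ2 Pr Z f f z)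
    \<longleftrightarrow>
    (\<forall>d. \<forall>f\<in>suitable_mat S d. AE z in \<mu>.
       loewner_le d (carre_du_champ_mat Pr Z d f f z)
         (complex_of_real c \<cdot>\<^sub>m carre_du_champ2_mat Pr Z d f f z))"
proof -
  interpret suitable_class W Pr Z \<mu> S by fact
  show ?thesis using scalar_imp_matrix matrix_imp_scalar by blast
qed

end
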